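(* Fix $\delta>0$ and $N\ge3$. Let $\mathcal H(t)=(\mathbf x(t),A^{(1)}(t),A^{(2)}(t))$ be an adaptive triadic network dynamical system, considered in the semi-simplicial regime with no symmetry identifications among the entries. Suppose the vector field is $C^1$ on $\mathbb{R}^{N+N^2+N^3}\setminus\mathcal H_0$, where $\mathcal{H}_0=\bigcup_{i<j}\{A^{(1)}_{ij}=0\}\cup\bigcup_{i<j<k}\{A^{(2)}_{ijk}=0\}$, and that the system is outward-pointing at threshold $\delta$ at every ordered triple $(i,j,k)$ of pairwise distinct indices. If at some time $t_1\ge0$ the configuration $(A^{(1)}(t_1),A^{(2)}(t_1))$ lies in $\Omega^{\mathrm{ss}}_\delta$, then $(A^{(1)}(t),A^{(2)}(t))\in\Omega^{\mathrm{ss}}_\delta$ for all $t\ge t_1$.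
   Context: An adaptive triadic network dynamical system on $N\ge3$ nodes: node states $x_i(t)$ in a smooth manifold, a matrix $A^{(1)}(t)\in\mathbb{R}^{N\times N}$ and tensor $A^{(2)}(t)\in(\mathbb{R}^N)^{\otimes3}$ (no symmetry assumed) evolving by ODEs $\dot x_i=f_i(\omega_i,\mathbf x,A^{(1)},A^{(2)})$, $\dot A^{(1)}_{ij}=g^{(1)}_{ij}(A^{(1)},\mathbf x)$, $\dot A^{(2)}_{ijk}=g^{(2)}_{ijk}(A^{(2)},\mathbf x)$. For each ordered triple $(i,j,k)$ of pairwise distinct indices let $M^{2,\delta,\mathrm{ss}}_{ijk}=\{(A^{(2)}_{ijk},A^{(1)}_{ij},A^{(1)}_{ik},A^{(1)}_{jk})\in\mathbb{R}^4:|A^{(2)}_{ijk}|\ge\delta\text{ and }\min(|A^{(1)}_{ij}|,|A^{(1)}_{ik}|,|A^{(1)}_{jk}|)<\delta\}$, $K^{\mathrm{ss}}_{ijk}=\mathbb{R}^4\setminus M^{2,\delta,\mathrm{ss}}_{ijk}$, and $\Omega^{\mathrm{ss}}_\delta=\prod_{(i,j,k)\text{ pairwise distinct}}K^{\mathrm{ss}}_{ijk}\subseteq\mathbb{R}^{4N(N-1)(N-2)}$. The boundary of $M^{2,\delta,\mathrm{ss}}_{ijk}$ is $X_1\cup\dots\cup X_4$: $X_1=\{|A^{(2)}_{ijk}|=\delta,\min(|A^{(1)}_{ij}|,|A^{(1)}_{ik}|,|A^{(1)}_{jk}|)\le\delta\}$, $X_2=\{|A^{(2)}_{ijk}|\ge\delta,|A^{(1)}_{ij}|=\delta,|A^{(1)}_{ik}|\ge\delta,|A^{(1)}_{jk}|\ge\delta\}$,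 $X_3=\{|A^{(2)}_{ijk}|\ge\delta,|A^{(1)}_{ik}|=\delta,|A^{(1)}_{ij}|\ge\delta,|A^{(1)}_{jk}|\ge\delta\}$, $X_4=\{|A^{(2)}_{ijk}|\ge\delta,|A^{(1)}_{jk}|=\delta,|A^{(1)}_{ij}|\ge\delta,|A^{(1)}_{ik}|\ge\delta\}$, with normals $n_1=(-\mathrm{sgn}A^{(2)}_{ijk},0,0,0)$, $n_2=(0,\mathrm{sgn}A^{(1)}_{ij},0,0)$, $n_3=(0,0,\mathrm{sgn}A^{(1)}_{ik},0)$, $n_4=(0,0,0,\mathrm{sgn}A^{(1)}_{jk})$; the normal cone at $x$ is the set of nonnegative combinations of the $n_\ell(x)$ for the pieces $X_\ell$ containing $x$. With $F^{(ijk)}=(\dot A^{(2)}_{ijk},\dot A^{(1)}_{ij},\dot A^{(1)}_{ik},\dot A^{(1)}_{jk})$, the system is outward-pointing at threshold $\delta$ if $n\cdot F^{(ijk)}(x)\ge0$ for every boundary point $x$ and every $n$ in its normal cone; equivalently $\mathrm{sgn}(A^{(2)}_{ijk})\dot A^{(2)}_{ijk}\le0$ on $X_1$ and $\mathrm{sgn}(A^{(1)}_{ab})\dot A^{(1)}_{ab}\ge0$ on the piece where $|A^{(1)}_{ab}|=\delta$.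
   Formalization: The formal theorem additionally assumes the vector field is locally Lipschitz at those points of H_0 that the trajectory visits (no condition if it avoids H_0); without this the claim fails. The solution may live on any interval in [0,∞), with the conclusion for t ≥ t_1 in it. *)

theory Defs
  imports "HOL-Analysis.Analysis"
begin

text \<open>
  The \<open>N\<close> nodes are the elements of a finite linearly ordered type \<open>'n\<close>. Node states are real,
  so the phase space is \<open>\<real>\<^bsup>N + N\<^sup>2 + N\<^sup>3\<^esup>\<close>. The parameters \<open>\<omega> i\<close> may have any type.
\<close>

type_synonym 'n nodes = "real ^ 'n"
type_synonym 'n adj1 = "real ^ 'n ^ 'n"
type_synonym 'n adj2 = "real ^ 'n ^ 'n ^ 'n"
type_synonym 'n state = "'n nodes \<times> 'n adj1 \<times> 'n adj2"
type_synonym r4 = "real \<times> real \<times> real \<times> real"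

definition vector_field ::
  "('n \<Rightarrow> 'w \<Rightarrow> 'n nodes \<Rightarrow> 'n adj1 \<Rightarrow> 'n adj2 \<Rightarrow> real) \<Rightarrow>
   ('n \<Rightarrow> 'n \<Rightarrow> 'n adj1 \<Rightarrow> 'n nodes \<Rightarrow> real) \<Rightarrow>
   ('n \<Rightarrow> 'n \<Rightarrow> 'n \<Rightarrow> 'n adj2 \<Rightarrow> 'n nodes \<Rightarrow> real) \<Rightarrow>
   ('n \<Rightarrow> 'w) \<Rightarrow> 'n::finite state \<Rightarrow> 'n state" where
  "vector_field f g1 g2 \<omega> = (\<lambda>(x, A1, A2).
     (\<chi> i. f i (\<omega> i) x A1 A2,
      \<chi> i j. g1 i j A1 x,
      \<chi> i j k. g2 i j k A2 x))"

definition solves_on :: "('a::real_normed_vector \<Rightarrow> 'a) \<Rightarrow> (real \<Rightarrow> 'a) \<Rightarrow> real set \<Rightarrow> bool" where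
  "solves_on F u J \<longleftrightarrow> (\<forall>t\<in>J. (u has_vector_derivative F (u t)) (at t within J))"

definition C1_on :: "('a::real_normed_vector \<Rightarrow> 'b::real_normed_vector) \<Rightarrow> 'a set \<Rightarrow> bool" where
  "C1_on F S \<longleftrightarrow> (\<exists>F' :: 'a \<Rightarrow> 'a \<Rightarrow>\<^sub>L 'b.
     (\<forall>p\<in>S. (F has_derivative blinfun_apply (F' p)) (at p)) \<and> continuous_on S F')"

text \<open>
  Used only at states of a trajectory lying on \<open>H0\<close> below, where the field need not be \<open>C\<^sup>1\<close>.
  Without any regularity there forward invariance fails: if \<open>\<delta> = 1\<close> and all rates vanish except
  \<open>A2\<^sub>3\<^sub>2\<^sub>1' = sqrt \<bar>1 - A2\<^sub>3\<^sub>2\<^sub>1\<bar>\<close> for \<open>A2\<^sub>1\<^sub>2\<^sub>3 = 0\<close>, \<open>\<bar>A2\<^sub>3\<^sub>2\<^sub>1\<bar> \<le> 1\<close>, then \<open>A2\<^sub>3\<^sub>2\<^sub>1\<close> grows from 0 to 1 in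
  finite time.
\<close>

definition locally_lipschitz_at :: "('a::metric_space \<Rightarrow> 'b::metric_space) \<Rightarrow> 'a \<Rightarrow> bool" where
  "locally_lipschitz_at F p \<longleftrightarrow> (\<exists>\<epsilon>>0. \<exists>L. L-lipschitz_on (ball p \<epsilon>) F)"

definition H0 :: "'n::{finite,linorder} state set" where
  "H0 = {(x, A1, A2). (\<exists>i j. i < j \<and> A1 $ i $ j = 0) \<or>
                      (\<exists>i j k. i < j \<and> j < k \<and> A2 $ i $ j $ k = 0)}"

text \<open>Points of \<open>\<real>\<^sup>4\<close> are written \<open>(a, b, c, d) = (A2\<^sub>i\<^sub>j\<^sub>k, A1\<^sub>i\<^sub>j, A1\<^sub>i\<^sub>k, A1\<^sub>j\<^sub>k)\<close>.\<close>

definition M_ss :: "real \<Rightarrow> r4 set" where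
  "M_ss \<delta> = {(a, b, c, d). \<bar>a\<bar> \<ge> \<delta> \<and> min \<bar>b\<bar> (min \<bar>c\<bar> \<bar>d\<bar>) < \<delta>}"

definition K_ss :: "real \<Rightarrow> r4 set" where
  "K_ss \<delta> = UNIV - M_ss \<delta>"

definition X1 :: "real \<Rightarrow> r4 set" where
  "X1 \<delta> = {(a, b, c, d). \<bar>a\<bar> = \<delta> \<and> min \<bar>b\<bar> (min \<bar>c\<bar> \<bar>d\<bar>) \<le> \<delta>}"

definition X2 :: "real \<Rightarrow> r4 set" where
  "X2 \<delta> = {(a, b, c, d). \<bar>a\<bar> \<ge> \<delta> \<and> \<bar>b\<bar> = \<delta> \<and> \<bar>c\<bar> \<ge> \<delta> \<and> \<bar>d\<bar> \<ge> \<delta>}"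

definition X3 :: "real \<Rightarrow> r4 set" where
  "X3 \<delta> = {(a, b, c, d). \<bar>a\<bar> \<ge> \<delta> \<and> \<bar>c\<bar> = \<delta> \<and> \<bar>b\<bar> \<ge> \<delta> \<and> \<bar>d\<bar> \<ge> \<delta>}"

definition X4 :: "real \<Rightarrow> r4 set" where
  "X4 \<delta> = {(a, b, c, d). \<bar>a\<bar> \<ge> \<delta> \<and> \<bar>d\<bar> = \<delta> \<and> \<bar>b\<bar> \<ge> \<delta> \<and> \<bar>c\<bar> \<ge> \<delta>}"

definition n1 :: "r4 \<Rightarrow> r4" where "n1 = (\<lambda>(a, b, c, d). (- sgn a, 0, 0, 0))"
definition n2 :: "r4 \<Rightarrow> r4" where "n2 = (\<lambda>(a, b, c, d). (0, sgn b, 0, 0))"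
definition n3 :: "r4 \<Rightarrow> r4" where "n3 = (\<lambda>(a, b, c, d). (0, 0, sgn c, 0))"
definition n4 :: "r4 \<Rightarrow> r4" where "n4 = (\<lambda>(a, b, c, d). (0, 0, 0, sgn d))"

definition normal_cone :: "real \<Rightarrow> r4 \<Rightarrow> r4 set" where
  "normal_cone \<delta> p =
     {c1 *\<^sub>R n1 p + c2 *\<^sub>R n2 p + c3 *\<^sub>R n3 p + c4 *\<^sub>R n4 p | c1 c2 c3 c4.
        0 \<le> c1 \<and> 0 \<le> c2 \<and> 0 \<le> c3 \<and> 0 \<le> c4 \<and>
        (p \<notin> X1 \<delta> \<longrightarrow> c1 = 0) \<and> (p \<notin> X2 \<delta> \<longrightarrow> c2 = 0) \<and>
        (p \<notin> X3 \<delta> \<longrightarrow> c3 = 0) \<and> (p \<notin> X4 \<delta> \<longrightarrow> c4 = 0)}"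

definition coords :: "'n::finite adj1 \<Rightarrow> 'n adj2 \<Rightarrow> 'n \<times> 'n \<times> 'n \<Rightarrow> r4" where
  "coords A1 A2 = (\<lambda>(i, j, k). (A2 $ i $ j $ k, A1 $ i $ j, A1 $ i $ k, A1 $ j $ k))"

definition F_triple ::
  "('n \<Rightarrow> 'n \<Rightarrow> 'n adj1 \<Rightarrow> 'n nodes \<Rightarrow> real) \<Rightarrow>
   ('n \<Rightarrow> 'n \<Rightarrow> 'n \<Rightarrow> 'n adj2 \<Rightarrow> 'n nodes \<Rightarrow> real) \<Rightarrow>
   'n \<times> 'n \<times> 'n \<Rightarrow> 'n::finite state \<Rightarrow> r4" where
  "F_triple g1 g2 = (\<lambda>(i, j, k) (x, A1, A2). (g2 i j k A2 x, g1 i j A1 x, g1 i k A1 x, g1 j k A1 x))"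

text \<open>
  The rates of the four coordinates of a triple depend on the whole state, not only on the
  point of \<open>\<real>\<^sup>4\<close>; the condition is imposed at every state lying over a boundary point.
\<close>

definition outward_pointing_at ::
  "real \<Rightarrow>
   ('n \<Rightarrow> 'n \<Rightarrow> 'n adj1 \<Rightarrow> 'n nodes \<Rightarrow> real) \<Rightarrow>
   ('n \<Rightarrow> 'n \<Rightarrow> 'n \<Rightarrow> 'n adj2 \<Rightarrow> 'n nodes \<Rightarrow> real) \<Rightarrow>
   'n::finite \<times> 'n \<times> 'n \<Rightarrow> bool" where
  "outward_pointing_at \<delta> g1 g2 \<tau> \<longleftrightarrow>
     (\<forall>x A1 A2. coords A1 A2 \<tau> \<in> frontier (M_ss \<delta>) \<longrightarrow>
        (\<forall>n \<in> normal_cone \<delta> (coords A1 A2 \<tau>). n \<bullet> F_triple g1 g2 \<tau> (x, A1, A2) \<ge> 0))"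

definition distinct_triples :: "('n \<times> 'n \<times> 'n) set" where
  "distinct_triples = {(i, j, k). i \<noteq> j \<and> i \<noteq> k \<and> j \<noteq> k}"

definition Omega_ss :: "real \<Rightarrow> ('n \<times> 'n \<times> 'n \<Rightarrow> r4) set" where
  "Omega_ss \<delta> = (\<Pi>\<^sub>E \<tau> \<in> distinct_triples. K_ss \<delta>)"

definition config :: "'n::finite adj1 \<Rightarrow> 'n adj2 \<Rightarrow> 'n \<times> 'n \<times> 'n \<Rightarrow> r4" where
  "config A1 A2 = restrict (coords A1 A2) distinct_triples"

lemma config_in_Omega_ss_iff:
  "config A1 A2 \<in> Omega_ss \<delta> \<longleftrightarrow> (\<forall>\<tau>\<in>distinct_triples. coords A1 A2 \<tau> \<notin> M_ss \<delta>)"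
  by (auto simp: config_def Omega_ss_def K_ss_def PiE_iff)

lemma frontier_M_ss:
  assumes "\<delta> > 0"
  shows "frontier (M_ss \<delta>) = X1 \<delta> \<union> X2 \<delta> \<union> X3 \<delta> \<union> X4 \<delta>"
proof -
  define m :: "r4 \<Rightarrow> real" where "m = (\<lambda>p. min \<bar>fst (snd p)\<bar> (min \<bar>fst (snd (snd p))\<bar> \<bar>snd (snd (snd p))\<bar>))"
  have cm: "continuous_on S m" for S
    unfolding m_def by (intro continuous_intros)
  have M: "M_ss \<delta> = {p. \<bar>fst p\<bar> \<ge> \<delta> \<and> m p < \<delta>}"
    by (auto simp: M_ss_def m_def)
  have X: "X1 \<delta> \<union> X2 \<delta> \<union> X3 \<delta> \<union> X4 \<delta>
      = {p. \<bar>fst p\<bar> \<ge> \<delta> \<and> m p \<le> \<delta>} - {p. \<bar>fst p\<bar> > \<delta> \<and> m p < \<delta>}"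
  proof -
    have "(a = \<delta> \<and> min b (min c d) \<le> \<delta>) \<or> (\<delta> \<le> a \<and> b = \<delta> \<and> \<delta> \<le> c \<and> \<delta> \<le> d) \<or>
        (\<delta> \<le> a \<and> c = \<delta> \<and> \<delta> \<le> b \<and> \<delta> \<le> d) \<or> (\<delta> \<le> a \<and> d = \<delta> \<and> \<delta> \<le> b \<and> \<delta> \<le> c) \<longleftrightarrow>
        (\<delta> \<le> a \<and> min b (min c d) \<le> \<delta>) \<and> \<not> (\<delta> < a \<and> min b (min c d) < \<delta>)" for a b c d :: real
      unfolding min_le_iff_disj min_less_iff_disj by linarith
    note this[of "\<bar>_\<bar>" "\<bar>_\<bar>" "\<bar>_\<bar>" "\<bar>_\<bar>"]
    then show ?thesis
      by (simp add: X1_def X2_def X3_def X4_def m_def set_eq_iff)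
  qed
  have cl: "closure (M_ss \<delta>) = {p. \<bar>fst p\<bar> \<ge> \<delta> \<and> m p \<le> \<delta>}"
  proof
    have "closed {p. \<bar>fst p\<bar> \<ge> \<delta> \<and> m p \<le> \<delta>}"
      by (intro closed_Collect_conj closed_Collect_le continuous_intros cm)
    then show "closure (M_ss \<delta>) \<subseteq> {p. \<bar>fst p\<bar> \<ge> \<delta> \<and> m p \<le> \<delta>}"
      by (rule closure_minimal[rotated]) (auto simp: M)
    show "{p. \<bar>fst p\<bar> \<ge> \<delta> \<and> m p \<le> \<delta>} \<subseteq> closure (M_ss \<delta>)"
    proof
      fix p assume p: "p \<in> {p. \<bar>fst p\<bar> \<ge> \<delta> \<and> m p \<le> \<delta>}"
      define q where "q = (\<lambda>s::real. (fst p, s *\<^sub>R snd p))"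
      have mq: "m (q s) = s * m p" if "0 < s" for s
        using that by (simp add: m_def q_def abs_mult min_mult_distrib_left)
      have "m (q s) < \<delta>" if "0 < s" "s < 1" for s
      proof -
        have "0 \<le> m p" by (simp add: m_def)
        then have "s * m p \<le> s * \<delta>" "s * \<delta> < \<delta>" using p that assms by auto
        then show ?thesis unfolding mq[OF that(1)] by linarith
      qed
      then have "eventually (\<lambda>s. q s \<in> M_ss \<delta>) (at_left 1)"
        using p by (intro eventually_at_leftI[of 0]) (auto simp: M q_def)
      then have "eventually (\<lambda>s. q s \<in> closure (M_ss \<delta>)) (at_left 1)"
        by (rule eventually_mono) (use closure_subset in blast)
      moreover have "(q \<longlongrightarrow> (fst p, 1 *\<^sub>R snd p)) (at_left 1)"
        unfolding q_def by (intro tendsto_intros)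
      ultimately show "p \<in> closure (M_ss \<delta>)"
        using Lim_in_closed_set[of "closure (M_ss \<delta>)" q "at_left 1" p] by simp
    qed
  qed
  have int: "interior (M_ss \<delta>) = {p. \<bar>fst p\<bar> > \<delta> \<and> m p < \<delta>}"
  proof
    have "open {p. \<bar>fst p\<bar> > \<delta> \<and> m p < \<delta>}"
      by (intro open_Collect_conj open_Collect_less continuous_intros cm)
    then show "{p. \<bar>fst p\<bar> > \<delta> \<and> m p < \<delta>} \<subseteq> interior (M_ss \<delta>)"
      by (rule interior_maximal[rotated]) (auto simp: M)
    show "interior (M_ss \<delta>) \<subseteq> {p. \<bar>fst p\<bar> > \<delta> \<and> m p < \<delta>}"
    proof
      fix p assume p: "p \<in> interior (M_ss \<delta>)"
      define q where "q = (\<lambda>s::real. (s *\<^sub>R fst p, snd p))"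
      have "(q \<longlongrightarrow> (1 *\<^sub>R fst p, snd p)) (at_left 1)"
        unfolding q_def by (intro tendsto_intros)
      then have "eventually (\<lambda>s. q s \<in> interior (M_ss \<delta>)) (at_left 1)"
        using p by (intro topological_tendstoD) auto
      moreover have "eventually (\<lambda>s. 0 < s \<and> s < 1) (at_left (1::real))"
        by (intro eventually_at_leftI[of 0]) auto
      ultimately have "eventually (\<lambda>s. q s \<in> interior (M_ss \<delta>) \<and> 0 < s \<and> s < 1) (at_left (1::real))"
        by eventually_elim auto
      then obtain s where s: "q s \<in> interior (M_ss \<delta>)" "0 < s" "s < 1"
        using eventually_happens'[OF trivial_limit_at_left_real[of "1::real"]] by blast
      then have "q s \<in> M_ss \<delta>" using interior_subset by blast
      then have "\<delta> \<le> s * \<bar>fst p\<bar>" using s by (simp add: M q_def abs_mult)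
      moreover have "fst p \<noteq> 0" using calculation assms by auto
      ultimately have "\<delta> < \<bar>fst p\<bar>" using s by (smt (verit) mult_less_cancel_right2)
      moreover have "m p < \<delta>" using p interior_subset by (auto simp: M)
      ultimately show "p \<in> {p. \<bar>fst p\<bar> > \<delta> \<and> m p < \<delta>}" by simp
    qed
  qed
  show ?thesis unfolding frontier_def cl int X ..
qed

end

theory Submission
  imports Defs
begin

text \<open>
  Since \<open>g2\<close> does not see \<open>A1\<close> and \<open>g1\<close> does not see \<open>A2\<close>, the outward-pointing condition decouples.
  On the whole hyperplane \<open>\<sigma> A2\<^sub>i\<^sub>j\<^sub>k = \<delta>\<close> the rate of \<open>\<sigma> A2\<^sub>i\<^sub>j\<^sub>k\<close> is nonpositive, so the closed half space
  \<open>\<sigma> A2\<^sub>i\<^sub>j\<^sub>k \<ge> \<delta>\<close> is backward invariant and the strict inequality \<open>\<bar>A2\<^sub>i\<^sub>j\<^sub>k\<bar> < \<delta>\<close> persists forward.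
  Independently of \<open>A2\<close>, the closed octant in which the three edges of the triple keep their signs and
  have modulus at least \<open>\<delta>\<close> is forward invariant. Both are instances of invariance of an orthant for
  a locally Lipschitz field: by comparing the field at \<open>u\<close> and at the projection of \<open>u\<close>, the squared
  distance \<open>V\<close> to the orthant satisfies \<open>V' \<le> K V\<close> along a solution.
\<close>

section \<open>Calculus for the squared distance to an orthant\<close>

text \<open>Squaring smooths the corner of the negative part: at 0 the difference quotient is
  \<open>min h 0\<close>, which tends to 0. This makes the squared distance differentiable along
  solutions even when they cross a wall.\<close>

lemma has_real_derivative_min_0_squared:
  "((\<lambda>y::real. (min y 0)\<^sup>2) has_real_derivative 2 * min y 0) (at y)"
proof -
  consider "y < 0" | "y > 0" | "y = 0" by linarith
  then show ?thesis
  proof cases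
    case 1
    have "((\<lambda>y::real. y\<^sup>2) has_real_derivative 2 * min y 0) (at y)"
      using 1 by (auto intro!: derivative_eq_intros)
    then show ?thesis
      by (rule has_field_derivative_transform_within_open[where S = "{..<0}"]) (use 1 in auto)
  next
    case 2
    have "((\<lambda>y::real. 0) has_real_derivative 2 * min y 0) (at y)"
      using 2 by (auto intro!: derivative_eq_intros)
    then show ?thesis
      by (rule has_field_derivative_transform_within_open[where S = "{0<..}"]) (use 2 in auto)
  next
    case 3
    have "((\<lambda>h::real. min h 0) \<longlongrightarrow> min 0 0) (at 0)"
      by (intro tendsto_intros)
    moreover have "(min h 0)\<^sup>2 / h = min h 0" for h :: real
      by (simp add: power2_eq_square min_def)
    ultimately show ?thesis
      using 3 by (simp add: DERIV_def)
  qed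
qed

text \<open>Gronwall's argument: the integrating factor \<open>exp (- K * s)\<close> turns the
  differential inequality into monotonicity of the product.\<close>

lemma nonpos_if_deriv_le_mult:
  fixes V :: "real \<Rightarrow> real"
  assumes "a \<le> b" "V a \<le> 0"
    and deriv: "\<And>s. s \<in> {a..b} \<Longrightarrow> (V has_real_derivative V' s) (at s within {a..b})"
    and le: "\<And>s. s \<in> {a..b} \<Longrightarrow> V' s \<le> K * V s"
  shows "V b \<le> 0"
proof -
  have "\<exists>D. ((\<lambda>s. V s * exp (- K * s)) has_real_derivative D) (at s within {a..b}) \<and> D \<le> 0"
    if "a \<le> s" "s \<le> b" for s
  proof (intro exI conjI)
    show "((\<lambda>s. V s * exp (- K * s)) has_real_derivative (V' s - K * V s) * exp (- K * s))
        (at s within {a..b})"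
      using that by (auto intro!: derivative_eq_intros deriv simp: algebra_simps)
    show "(V' s - K * V s) * exp (- K * s) \<le> 0"
      using le[of s] that by (intro mult_nonpos_nonneg) auto
  qed
  then have "V b * exp (- K * b) \<le> V a * exp (- K * a)"
  proof (intro DERIV_nonpos_imp_decreasing_open[OF assms(1)])
    show "continuous_on {a..b} (\<lambda>s. V s * exp (- K * s))"
      using DERIV_continuous_on[OF deriv] by (intro continuous_intros)
  qed (metis at_within_Icc_at less_imp_le)
  also have "\<dots> \<le> 0"
    using assms(2) by (intro mult_nonpos_nonneg) auto
  finally show ?thesis
    by (simp add: mult_le_0_iff)
qed

section \<open>Invariance of orthants under locally Lipschitz fields\<close>

text \<open>The sign condition \<open>inward\<close> is known only on the walls of the orthant
  itself, so it is applied at projected points and transferred to the solution by the Lipschitz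
  bound. As that bound is local, the argument runs just after the last time in the orthant and
  contradicts its maximality.\<close>

lemma orthant_invariant:
  fixes n :: "'e \<Rightarrow> 'a::real_inner"
  assumes E: "finite E"
    and orthonormal: "\<And>e e'. e \<in> E \<Longrightarrow> e' \<in> E \<Longrightarrow> n e \<bullet> n e' = (if e = e' then 1 else 0)"
    and inward: "\<And>v e. e \<in> E \<Longrightarrow> (\<forall>e'\<in>E. c \<le> n e' \<bullet> v) \<Longrightarrow> n e \<bullet> v = c \<Longrightarrow> 0 \<le> n e \<bullet> G v"
    and sol: "solves_on G u {a..b}" and ab: "a \<le> b"
    and lip: "\<And>t. t \<in> {a..b} \<Longrightarrow> locally_lipschitz_at G (u t)"
    and init: "\<And>e. e \<in> E \<Longrightarrow> c \<le> n e \<bullet> u a"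
    and e: "e \<in> E"
  shows "c \<le> n e \<bullet> u b"
proof -
  define y where "y = (\<lambda>e t. n e \<bullet> u t - c)"
  define V where "V = (\<lambda>t. \<Sum>e\<in>E. (min (y e t) 0)\<^sup>2)"
  \<comment> \<open>Nearest-point projection onto the orthant: each coordinate below
    \<open>c\<close> is raised to \<open>c\<close>, and everything else is left unchanged.\<close>
  define p where "p = (\<lambda>v. v - (\<Sum>e\<in>E. min (n e \<bullet> v - c) 0 *\<^sub>R n e))"
  have du: "(u has_vector_derivative G (u t)) (at t within {a..b})" if "t \<in> {a..b}" for t
    using sol that by (simp add: solves_on_def)
  have cu: "continuous_on {a..b} u"
    unfolding continuous_on_eq_continuous_within
    using du has_vector_derivative_continuous by blast
  have cV: "continuous_on {a..b} V"
    unfolding V_def y_def by (intro continuous_intros cu)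
  have dy: "(y e has_real_derivative n e \<bullet> G (u t)) (at t within {a..b})" if "t \<in> {a..b}" for e t
    using bounded_linear.has_vector_derivative[OF bounded_linear_inner_right[of "n e"] du[OF that]]
    unfolding y_def has_real_derivative_iff_has_vector_derivative
    by (auto intro!: derivative_eq_intros)
  have dV: "(V has_real_derivative (\<Sum>e\<in>E. 2 * min (y e t) 0 * (n e \<bullet> G (u t)))) (at t within {a..b})"
    if "t \<in> {a..b}" for t
    unfolding V_def
    by (intro DERIV_sum DERIV_chain2[OF has_real_derivative_min_0_squared] dy that)
  have V_nonneg: "0 \<le> V t" for t
    unfolding V_def by (simp add: sum_nonneg)
  have V0: "V t = 0 \<longleftrightarrow> (\<forall>e\<in>E. c \<le> n e \<bullet> u t)" for t
    using E by (auto simp: V_def y_def sum_nonneg_eq_0_iff min_def)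
  have inner_p: "n e \<bullet> p v = max (n e \<bullet> v) c" if "e \<in> E" for e v
    using that E by (simp add: p_def inner_diff_right inner_sum_right orthonormal if_distrib
        sum.delta cong: if_cong)
  have norm_p: "norm (v - p v) \<le> (\<Sum>e\<in>E. \<bar>min (n e \<bullet> v - c) 0\<bar>)" for v
  proof -
    have "norm (n e) = 1" if "e \<in> E" for e
      using that by (simp add: norm_eq_sqrt_inner orthonormal)
    then show ?thesis
      unfolding p_def by (auto intro!: sum_norm_le)
  qed
  have "V b = 0"
  proof (rule ccontr)
    assume Vb: "V b \<noteq> 0"
    \<comment> \<open>By compactness there is a last zero \<open>r\<close> of \<open>V\<close>. If
      \<open>V b\<close> were nonzero, \<open>r\<close> would precede \<open>b\<close>, and any
      later zero gives the contradiction.\<close>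
    define Z where "Z = {t \<in> {a..b}. V t = 0}"
    have "closed Z"
      unfolding Z_def using continuous_closed_preimage_constant[OF cV, of 0] by simp
    moreover have "bounded Z"
      by (rule bounded_subset[OF bounded_closed_interval[of a b]]) (auto simp: Z_def)
    ultimately have "compact Z"
      by (simp add: compact_eq_bounded_closed)
    moreover have "a \<in> Z"
      using ab init V0 by (auto simp: Z_def)
    ultimately obtain r where r: "r \<in> Z" and r_max: "\<And>t. t \<in> Z \<Longrightarrow> t \<le> r"
      using compact_attains_sup[of Z] by blast
    then have rab: "r \<in> {a..b}" and Vr: "V r = 0" and "r < b"
      using Vb by (auto simp: Z_def order.order_iff_strict)
    obtain \<epsilon> L where "\<epsilon> > 0" and L: "L-lipschitz_on (ball (u r) \<epsilon>) G"
      using lip[OF rab] by (auto simp: locally_lipschitz_at_def)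
    \<comment> \<open>Since \<open>p\<close> is continuous and fixes \<open>u r\<close>, both the
      solution and its projection stay near time \<open>r\<close> in the one ball where
      \<open>L\<close> is valid.\<close>
    have "p (u r) = u r"
      using Vr V0 by (simp add: p_def)
    have cont_r: "(u \<longlongrightarrow> u r) (at r within {a..b})"
      using cu rab by (simp add: continuous_on_def)
    have "((\<lambda>t. p (u t)) \<longlongrightarrow> p (u r)) (at r within {a..b})"
      unfolding p_def by (intro tendsto_intros cont_r)
    with cont_r have "eventually (\<lambda>t. dist (u t) (u r) < \<epsilon> \<and> dist (p (u t)) (u r) < \<epsilon>) (at r within {a..b})"
      using \<open>\<epsilon> > 0\<close> \<open>p (u r) = u r\<close> by (auto intro!: eventually_conj tendstoD)
    then obtain \<eta> where "\<eta> > 0" and \<eta>: "\<And>t. t \<in> {a..b} \<Longrightarrow> t \<noteq> r \<Longrightarrow> dist t r < \<eta> \<Longrightarrow>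
        dist (u t) (u r) < \<epsilon> \<and> dist (p (u t)) (u r) < \<epsilon>"
      unfolding eventually_at by blast
    have near: "u t \<in> ball (u r) \<epsilon>" "p (u t) \<in> ball (u r) \<epsilon>" if "t \<in> {a..b}" "dist t r < \<eta>" for t
      using \<eta>[OF that(1) _ that(2)] \<open>\<epsilon> > 0\<close> \<open>p (u r) = u r\<close> by (cases "t = r"; simp add: dist_commute)+
    define q where "q = min b (r + \<eta> / 2)"
    have q: "r < q" "q \<le> b" "q < r + \<eta>"
      using \<open>r < b\<close> \<open>\<eta> > 0\<close> by (auto simp: q_def)
    \<comment> \<open>In \<open>K\<close>, the 2 comes from differentiating the square,
      \<open>L\<close> from comparing the field at a point and at its projection, and
      \<open>card E\<close> from Cauchy-Schwarz applied to the sum \<open>D\<close>.\<close>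
    have "V q \<le> 0"
    proof (rule nonpos_if_deriv_le_mult[where a = r and b = q and V = V and K = "2 * L * card E"
          and V' = "\<lambda>s. \<Sum>e\<in>E. 2 * min (y e s) 0 * (n e \<bullet> G (u s))"])
      show "r \<le> q" "V r \<le> 0" using q Vr by auto
    next
      fix s assume "s \<in> {r..q}"
      then have s: "s \<in> {a..b}" "dist s r < \<eta>"
        using rab q by (auto simp: dist_real_def)
      show "(V has_real_derivative (\<Sum>e\<in>E. 2 * min (y e s) 0 * (n e \<bullet> G (u s)))) (at s within {r..q})"
        by (rule DERIV_subset[OF dV[OF s(1)]]) (use rab q in auto)
      \<comment> \<open>The l1 norm of the deficits. It bounds the distance from \<open>u s\<close>
        to \<open>p (u s)\<close> because the normals are unit vectors.\<close>
      define D where "D = (\<Sum>e\<in>E. \<bar>min (y e s) 0\<bar>)"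
      have L0: "0 \<le> L" using L by (simp add: lipschitz_on_def)
      have "2 * min (y e s) 0 * (n e \<bullet> G (u s)) \<le> 2 * \<bar>min (y e s) 0\<bar> * (L * D)" if e: "e \<in> E" for e
      proof (cases "y e s < 0")
        case True
        \<comment> \<open>A coordinate below \<open>c\<close> is projected to exactly
          \<open>c\<close>, so \<open>p (u s)\<close> lies on wall \<open>e\<close> of the orthant,
          where \<open>inward\<close> applies. Passing back to \<open>u s\<close> costs at most
          \<open>L * D\<close>.\<close>
        have "0 \<le> n e \<bullet> G (p (u s))"
          by (rule inward[OF e]) (use True e in \<open>auto simp: inner_p y_def\<close>)
        moreover have "\<bar>n e \<bullet> (G (u s) - G (p (u s)))\<bar> \<le> norm (G (u s) - G (p (u s)))"
          using Cauchy_Schwarz_ineq2[of "n e" "G (u s) - G (p (u s))"] e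
          by (simp add: norm_eq_sqrt_inner[of "n e"] orthonormal)
        moreover have "norm (G (u s) - G (p (u s))) \<le> L * norm (u s - p (u s))"
          using lipschitz_onD[OF L near[OF s]] by (simp add: dist_norm)
        moreover have "L * norm (u s - p (u s)) \<le> L * D"
          using norm_p[of "u s"] L0 by (intro mult_left_mono) (auto simp: D_def y_def)
        ultimately have "- (n e \<bullet> G (u s)) \<le> L * D"
          by (simp add: inner_diff_right)
        then have "2 * \<bar>min (y e s) 0\<bar> * - (n e \<bullet> G (u s)) \<le> 2 * \<bar>min (y e s) 0\<bar> * (L * D)"
          by (intro mult_left_mono) auto
        then show ?thesis using True by simp
      qed auto
      then have "(\<Sum>e\<in>E. 2 * min (y e s) 0 * (n e \<bullet> G (u s))) \<le> (\<Sum>e\<in>E. 2 * \<bar>min (y e s) 0\<bar> * (L * D))"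
        by (rule sum_mono)
      also have "\<dots> = 2 * L * D\<^sup>2"
        by (simp add: D_def sum_distrib_left sum_distrib_right power2_eq_square mult_ac)
      also have "\<dots> \<le> 2 * L * (card E * V s)"
      proof (intro mult_left_mono)
        show "D\<^sup>2 \<le> card E * V s"
          using sum_squared_le_sum_of_squares[of "\<lambda>e. \<bar>min (y e s) 0\<bar>" E] E
          by (simp add: D_def V_def mult.commute)
      qed (use L0 in auto)
      finally show "(\<Sum>e\<in>E. 2 * min (y e s) 0 * (n e \<bullet> G (u s))) \<le> (2 * L * card E) * V s"
        by (simp add: mult.assoc)
    qed
    then have "q \<in> Z"
      using V_nonneg[of q] q rab by (auto simp: Z_def)
    then show False
      using r_max q by fastforce
  qed
  then show ?thesis using V0 e by blast
qed

section \<open>Regularity of the field off the exceptional set\<close>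

text \<open>Continuity of the derivative bounds its norm by \<open>norm (F' p) + 1\<close> on a
  small ball inside \<open>S\<close>; balls are convex, so the mean value inequality
  applies.\<close>

lemma C1_on_imp_locally_lipschitz_at:
  fixes F :: "'a::real_normed_vector \<Rightarrow> 'b::real_normed_vector"
  assumes "C1_on F S" "open S" "p \<in> S"
  shows "locally_lipschitz_at F p"
proof -
  obtain F' :: "'a \<Rightarrow> 'a \<Rightarrow>\<^sub>L 'b" where F': "\<And>q. q \<in> S \<Longrightarrow> (F has_derivative blinfun_apply (F' q)) (at q)"
    and cF': "continuous_on S F'"
    using assms(1) by (auto simp: C1_on_def)
  have "(F' \<longlongrightarrow> F' p) (at p)"
    using cF' assms(2,3) by (metis continuous_on_eq_continuous_at continuous_at)
  then have "eventually (\<lambda>q. dist (F' q) (F' p) < 1) (at p)"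
    by (rule tendstoD) simp
  then obtain d where d: "d > 0" "\<And>q. q \<noteq> p \<Longrightarrow> dist q p < d \<Longrightarrow> dist (F' q) (F' p) < 1"
    unfolding eventually_at by auto
  obtain d' where d': "d' > 0" "ball p d' \<subseteq> S"
    using assms(2,3) open_contains_ball by blast
  have "(norm (F' p) + 1)-lipschitz_on (ball p (min d d')) F"
  proof (rule bounded_derivative_imp_lipschitz)
    fix q assume q: "q \<in> ball p (min d d')"
    show "(F has_derivative blinfun_apply (F' q)) (at q within ball p (min d d'))"
      using q d' by (auto intro: has_derivative_at_withinI[OF F'])
    have "dist (F' q) (F' p) < 1"
      using d(2)[of q] q by (cases "q = p") (auto simp: dist_commute)
    then have "norm (F' q) \<le> norm (F' p) + 1"
      using norm_triangle_sub[of "F' q" "F' p"] by (simp add: dist_norm)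
    then show "onorm (blinfun_apply (F' q)) \<le> norm (F' p) + 1"
      by (simp add: norm_blinfun.rep_eq)
  qed auto
  then show ?thesis
    using d d' unfolding locally_lipschitz_at_def by (meson min_less_iff_conj)
qed

text \<open>A finite union of coordinate hyperplanes. Its complement is therefore open, as the
  passage from \<open>C1_on\<close> to a local Lipschitz bound requires.\<close>

lemma closed_H0: "closed (H0 :: 'n::{finite,linorder} state set)"
proof -
  have H0: "H0 = (\<Union>(i, j)\<in>{(i, j). i < j}. {s :: 'n state. fst (snd s) $ i $ j = 0}) \<union>
      (\<Union>(i, j, k)\<in>{(i, j, k). i < j \<and> j < k}. {s. snd (snd s) $ i $ j $ k = 0})"
    by (auto simp: H0_def)
  have "closed {s :: 'n state. fst (snd s) $ i $ j = 0}" for i j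
    by (intro closed_Collect_eq continuous_intros)
  moreover have "closed {s :: 'n state. snd (snd s) $ i $ j $ k = 0}" for i j k
    by (intro closed_Collect_eq continuous_intros)
  ultimately show ?thesis
    unfolding H0 by (intro closed_Un closed_UN ballI finite) auto
qed

section \<open>From normal cones to signs of individual rates\<close>

lemma normals_in_normal_cone:
  "P \<in> X1 \<delta> \<Longrightarrow> n1 P \<in> normal_cone \<delta> P"
  "P \<in> X2 \<delta> \<Longrightarrow> n2 P \<in> normal_cone \<delta> P"
  "P \<in> X3 \<delta> \<Longrightarrow> n3 P \<in> normal_cone \<delta> P"
  "P \<in> X4 \<delta> \<Longrightarrow> n4 P \<in> normal_cone \<delta> P"
  unfolding normal_cone_def mem_Collect_eq
  by (rule exI[of _ 1], rule exI[of _ 0], rule exI[of _ 0], rule exI[of _ 0], simp)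
     (rule exI[of _ 0], rule exI[of _ 1], rule exI[of _ 0], rule exI[of _ 0], simp,
      rule exI[of _ 0], rule exI[of _ 0], rule exI[of _ 1], rule exI[of _ 0], simp,
      rule exI[of _ 0], rule exI[of _ 0], rule exI[of _ 0], rule exI[of _ 1], simp)

lemma outward_pointing_atD:
  assumes "\<delta> > 0" "outward_pointing_at \<delta> g1 g2 \<tau>"
    and "coords A1 A2 \<tau> \<in> X1 \<delta> \<union> X2 \<delta> \<union> X3 \<delta> \<union> X4 \<delta>"
    and "m \<in> normal_cone \<delta> (coords A1 A2 \<tau>)"
  shows "m \<bullet> F_triple g1 g2 \<tau> (x, A1, A2) \<ge> 0"
  using assms unfolding outward_pointing_at_def frontier_M_ss[OF assms(1)] by blast

text \<open>The rate \<open>g2\<close> does not see the edge weights, so they may be set to 0. The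
  minimum of their moduli is then below \<delta>, which puts the point on \<open>X1\<close>, and
  pairing with \<open>n1\<close> gives the sign.\<close>

lemma outward_pointing_at_face_rate:
  assumes "\<delta> > 0" "outward_pointing_at \<delta> g1 g2 (i, j, k)" "\<bar>A2 $ i $ j $ k\<bar> = \<delta>"
  shows "sgn (A2 $ i $ j $ k) * g2 i j k A2 x \<le> 0"
proof -
  have "coords 0 A2 (i, j, k) \<in> X1 \<delta>"
    using assms by (simp add: coords_def X1_def)
  then have "n1 (coords 0 A2 (i, j, k)) \<bullet> F_triple g1 g2 (i, j, k) (x, 0, A2) \<ge> 0"
    by (intro outward_pointing_atD[OF assms(1,2)] normals_in_normal_cone) auto
  then show ?thesis
    by (simp add: n1_def coords_def F_triple_def)
qed

text \<open>The rate \<open>g1\<close> does not see the triadic weights, so all of them may be set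
  to \<delta>. The point then lies on the piece belonging to the chosen edge; it lies on
  \<open>X1\<close> too, but only the normal of the edge is used.\<close>

lemma outward_pointing_at_edge_rate:
  fixes A1 :: "'n::finite adj1"
  assumes "\<delta> > 0" "outward_pointing_at \<delta> g1 g2 (i, j, k)"
    and ge: "\<bar>A1 $ i $ j\<bar> \<ge> \<delta>" "\<bar>A1 $ i $ k\<bar> \<ge> \<delta>" "\<bar>A1 $ j $ k\<bar> \<ge> \<delta>"
    and edge: "(i', j') \<in> {(i, j), (i, k), (j, k)}" and eq: "\<bar>A1 $ i' $ j'\<bar> = \<delta>"
  shows "sgn (A1 $ i' $ j') * g1 i' j' A1 x \<ge> 0"
proof -
  define A2 :: "'n adj2" where "A2 = (\<chi> i j k. \<delta>)"
  define P where "P = coords A1 A2 (i, j, k)"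
  have P: "P = (\<delta>, A1 $ i $ j, A1 $ i $ k, A1 $ j $ k)"
    by (simp add: P_def A2_def coords_def)
  have rate: "m \<bullet> F_triple g1 g2 (i, j, k) (x, A1, A2) \<ge> 0"
    if "P \<in> X1 \<delta> \<union> X2 \<delta> \<union> X3 \<delta> \<union> X4 \<delta>" "m \<in> normal_cone \<delta> P" for m
    using outward_pointing_atD[OF assms(1,2)] that by (simp add: P_def)
  consider "i' = i" "j' = j" | "i' = i" "j' = k" | "i' = j" "j' = k"
    using edge by auto
  then show ?thesis
  proof cases
    case 1
    then have "P \<in> X2 \<delta>"
      using ge eq \<open>\<delta> > 0\<close> by (simp add: P X2_def)
    then show ?thesis
      using rate[OF _ normals_in_normal_cone(2)] 1 by (simp add: P n2_def F_triple_def)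
  next
    case 2
    then have "P \<in> X3 \<delta>"
      using ge eq \<open>\<delta> > 0\<close> by (simp add: P X3_def)
    then show ?thesis
      using rate[OF _ normals_in_normal_cone(3)] 2 by (simp add: P n3_def F_triple_def)
  next
    case 3
    then have "P \<in> X4 \<delta>"
      using ge eq \<open>\<delta> > 0\<close> by (simp add: P X4_def)
    then show ?thesis
      using rate[OF _ normals_in_normal_cone(4)] 3 by (simp add: P n4_def F_triple_def)
  qed
qed

section \<open>Time reversal\<close>

text \<open>The chain rule for negation of time. It lets forward invariance of an orthant yield
  backward invariance for the original field.\<close>

lemma solves_on_reverse:
  assumes "solves_on F u {a..b}"
  shows "solves_on (\<lambda>v. - F v) (\<lambda>t. u (- t)) {- b..- a}"
  unfolding solves_on_def
proof
  fix t assume t: "t \<in> {- b..- a}"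
  have "(u has_vector_derivative F (u (- t))) (at (- t) within uminus ` {- b..- a})"
    using assms t by (simp add: solves_on_def)
  moreover have "(uminus has_real_derivative - 1) (at t within {- b..- a})"
    by (auto intro!: derivative_eq_intros)
  ultimately show "((\<lambda>t. u (- t)) has_vector_derivative - F (u (- t))) (at t within {- b..- a})"
    using vector_diff_chain_within[of uminus "-1" t "{- b..- a}" u "F (u (- t))"]
    by (simp add: has_real_derivative_iff_has_vector_derivative o_def)
qed

lemma locally_lipschitz_at_minus:
  fixes F :: "'a::metric_space \<Rightarrow> 'b::real_normed_vector"
  shows "locally_lipschitz_at F p \<Longrightarrow> locally_lipschitz_at (\<lambda>v. - F v) p"
  unfolding locally_lipschitz_at_def by (simp add: lipschitz_on_minus)

section \<open>Persistence of the two alternatives at each triple\<close>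

theorem theorem4p15:
  fixes \<delta> :: real
    and f :: "'n::{finite,linorder} \<Rightarrow> 'w \<Rightarrow> 'n nodes \<Rightarrow> 'n adj1 \<Rightarrow> 'n adj2 \<Rightarrow> real"
    and g1 :: "'n \<Rightarrow> 'n \<Rightarrow> 'n adj1 \<Rightarrow> 'n nodes \<Rightarrow> real"
    and g2 :: "'n \<Rightarrow> 'n \<Rightarrow> 'n \<Rightarrow> 'n adj2 \<Rightarrow> 'n nodes \<Rightarrow> real"
    and \<omega> :: "'n \<Rightarrow> 'w"
    and x :: "real \<Rightarrow> 'n nodes" and A1 :: "real \<Rightarrow> 'n adj1" and A2 :: "real \<Rightarrow> 'n adj2"
    and J :: "real set" and t1 :: real
  assumes "\<delta> > 0" and "CARD('n) \<ge> 3"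
    and "is_interval J" and "J \<subseteq> {0..}"
    and "solves_on (vector_field f g1 g2 \<omega>) (\<lambda>t. (x t, A1 t, A2 t)) J"
    and "C1_on (vector_field f g1 g2 \<omega>) (UNIV - H0)"
    and "\<forall>t\<in>J. (x t, A1 t, A2 t) \<in> H0 \<longrightarrow>
           locally_lipschitz_at (vector_field f g1 g2 \<omega>) (x t, A1 t, A2 t)"
    and "\<forall>\<tau>\<in>distinct_triples. outward_pointing_at \<delta> g1 g2 \<tau>"
    and "t1 \<in> J" and "config (A1 t1) (A2 t1) \<in> Omega_ss \<delta>"
  shows "\<forall>t\<in>J. t \<ge> t1 \<longrightarrow> config (A1 t) (A2 t) \<in> Omega_ss \<delta>"
proof (intro ballI impI)
  fix t assume t: "t \<in> J" "t1 \<le> t"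
  define F where "F = vector_field f g1 g2 \<omega>"
  define u where "u = (\<lambda>t. (x t, A1 t, A2 t))"
  have sub: "{t1..t} \<subseteq> J"
    using mem_is_interval_1_I[OF assms(3,9) t(1)] by auto
  have sol: "solves_on F u {t1..t}"
    using assms(5) has_vector_derivative_within_subset[OF _ sub] sub
    unfolding solves_on_def F_def u_def by blast
  have lip: "locally_lipschitz_at F (u s)" if "s \<in> {t1..t}" for s
  proof (cases "u s \<in> H0")
    case True
    then show ?thesis using assms(7) sub that by (auto simp: F_def u_def)
  next
    case False
    then show ?thesis
      using assms(6) closed_H0 by (auto simp: F_def intro!: C1_on_imp_locally_lipschitz_at)
  qed
  \<comment> \<open>By contradiction: if the modulus is at least \<delta> at time \<open>t\<close>,
    follow the solution backward from \<open>t\<close>. It stays in the half space with the sign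
    taken at \<open>t\<close>, so the modulus is at least \<delta> at \<open>t1\<close> as
    well.\<close>
  have face: "\<bar>A2 t $ i $ j $ k\<bar> < \<delta>"
    if out: "outward_pointing_at \<delta> g1 g2 (i, j, k)" and less: "\<bar>A2 t1 $ i $ j $ k\<bar> < \<delta>" for i j k
  proof (rule ccontr)
    assume ge: "\<not> \<bar>A2 t $ i $ j $ k\<bar> < \<delta>"
    define \<sigma> where "\<sigma> = sgn (A2 t $ i $ j $ k)"
    have \<sigma>: "\<sigma> = 1 \<or> \<sigma> = - 1"
      using ge \<open>\<delta> > 0\<close> by (auto simp: \<sigma>_def sgn_if)
    \<comment> \<open>A half space is an orthant with a single wall, hence the index type
      \<open>unit\<close>.\<close>
    define m :: "unit \<Rightarrow> 'n state" where "m = (\<lambda>_. (0, 0, axis i (axis j (axis k \<sigma>))))"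
    have m: "m e \<bullet> v = \<sigma> * snd (snd v) $ i $ j $ k" for e v
      by (cases v) (simp add: m_def inner_axis')
    have "\<delta> \<le> m () \<bullet> u (- (- t1))"
    proof (rule orthant_invariant[where E = UNIV and a = "- t" and b = "- t1" and n = m
          and G = "\<lambda>v. - F v" and u = "\<lambda>s. u (- s)"])
      show "solves_on (\<lambda>v. - F v) (\<lambda>s. u (- s)) {- t..- t1}"
        using sol by (rule solves_on_reverse)
      show "m e \<bullet> m e' = (if e = e' then 1 else 0)" for e e'
        using \<sigma> by (auto simp: m) (auto simp: m_def)
      show "\<delta> \<le> m e \<bullet> u (- (- t))" for e
        using ge by (simp add: m u_def \<sigma>_def sgn_mult_self_eq abs_sgn mult.commute)
      fix v :: "'n state" and e assume *: "m e \<bullet> v = \<delta>"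
      obtain X B1 B2 where v: "v = (X, B1, B2)" by (cases v) auto
      have "sgn (B2 $ i $ j $ k) = \<sigma>" "\<bar>B2 $ i $ j $ k\<bar> = \<delta>"
        using * \<sigma> \<open>\<delta> > 0\<close> by (auto simp: m v sgn_if)
      \<comment> \<open>Reversing time flips the sign of the field, so a nonpositive outward rate on
        the hyperplane becomes the inward condition.\<close>
      then show "0 \<le> m e \<bullet> - F v"
        using outward_pointing_at_face_rate[OF \<open>\<delta> > 0\<close> out, of B2 X]
        by (simp add: m v F_def vector_field_def)
    qed (use t lip in \<open>auto intro!: locally_lipschitz_at_minus\<close>)
    then show False
      using less \<sigma> by (auto simp: m u_def)
  qed
  have edges: "\<delta> \<le> \<bar>A1 t $ i' $ j'\<bar>"
    if out: "outward_pointing_at \<delta> g1 g2 (i, j, k)"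
      and ge: "\<And>i' j'. (i', j') \<in> {(i, j), (i, k), (j, k)} \<Longrightarrow> \<delta> \<le> \<bar>A1 t1 $ i' $ j'\<bar>"
      and e': "(i', j') \<in> {(i, j), (i, k), (j, k)}" for i j k i' j'
  proof -
    define E where "E = {(i, j), (i, k), (j, k)}"
    \<comment> \<open>The orthant is the one occupied at the initial time. These signs are nonzero
      because the moduli start at or above \<delta>.\<close>
    define \<sigma> where "\<sigma> = (\<lambda>e. sgn (A1 t1 $ fst e $ snd e))"
    have \<sigma>: "\<sigma> e = 1 \<or> \<sigma> e = - 1" if "e \<in> E" for e
      using ge[of "fst e" "snd e"] that \<open>\<delta> > 0\<close> by (auto simp: \<sigma>_def sgn_if E_def)
    define m :: "'n \<times> 'n \<Rightarrow> 'n state" where "m = (\<lambda>e. (0, axis (fst e) (axis (snd e) (\<sigma> e)), 0))"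
    have m: "m e \<bullet> v = \<sigma> e * fst (snd v) $ fst e $ snd e" for e v
      by (cases v) (simp add: m_def inner_axis')
    have sgn_abs: "sgn b = \<sigma> e \<and> \<bar>b\<bar> = \<sigma> e * b" if "e \<in> E" "\<delta> \<le> \<sigma> e * b" for e b
      using \<sigma>[OF that(1)] that(2) \<open>\<delta> > 0\<close> by (auto simp: sgn_if)
    have "\<delta> \<le> m (i', j') \<bullet> u t"
    proof (rule orthant_invariant[where E = E and a = t1 and b = t and n = m
          and G = F and u = u])
      show "m e \<bullet> m e' = (if e = e' then 1 else 0)" if "e \<in> E" "e' \<in> E" for e e'
        using \<sigma>[OF that(1)] by (auto simp: m) (auto simp: m_def axis_def prod_eq_iff split: if_splits)
      show "\<delta> \<le> m e \<bullet> u t1" if "e \<in> E" for e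
        using ge[of "fst e" "snd e"] that
        by (simp add: m u_def \<sigma>_def E_def abs_sgn mult.commute)
      fix v :: "'n state" and e
      assume e: "e \<in> E" and in_orthant: "\<forall>e'\<in>E. \<delta> \<le> m e' \<bullet> v" and eq: "m e \<bullet> v = \<delta>"
      obtain X B1 B2 where v: "v = (X, B1, B2)" by (cases v) auto
      have B1: "sgn (B1 $ fst e $ snd e) = \<sigma> e \<and> \<bar>B1 $ fst e $ snd e\<bar> = \<sigma> e * B1 $ fst e $ snd e
          \<and> \<bar>B1 $ fst e $ snd e\<bar> \<ge> \<delta>" if "e \<in> E" for e
        using sgn_abs[OF that, of "B1 $ fst e $ snd e"] in_orthant that by (auto simp: m v)
      \<comment> \<open>The three edges must be treated jointly: the sign of one rate at modulus
        \<delta> is available only while the other two moduli are at least \<delta>, which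
        membership of \<open>v\<close> in the orthant supplies.\<close>
      have "0 \<le> sgn (B1 $ fst e $ snd e) * g1 (fst e) (snd e) B1 X"
      proof (rule outward_pointing_at_edge_rate[OF \<open>\<delta> > 0\<close> out])
        show "\<delta> \<le> \<bar>B1 $ i $ j\<bar>" "\<delta> \<le> \<bar>B1 $ i $ k\<bar>" "\<delta> \<le> \<bar>B1 $ j $ k\<bar>"
          using B1[of "(i, j)"] B1[of "(i, k)"] B1[of "(j, k)"] by (auto simp: E_def)
        show "(fst e, snd e) \<in> {(i, j), (i, k), (j, k)}" "\<bar>B1 $ fst e $ snd e\<bar> = \<delta>"
          using e eq B1[OF e] by (auto simp: E_def m v)
      qed
      then show "0 \<le> m e \<bullet> F v"
        using B1[OF e] by (simp add: m v F_def vector_field_def)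
    qed (use t lip sol e' in \<open>auto simp: E_def\<close>)
    then show ?thesis
      using sgn_abs[of "(i', j')" "A1 t $ i' $ j'"] e' by (auto simp: E_def m u_def)
  qed
  show "config (A1 t) (A2 t) \<in> Omega_ss \<delta>"
    unfolding config_in_Omega_ss_iff
  proof
    fix \<tau> :: "'n \<times> 'n \<times> 'n" assume \<tau>: "\<tau> \<in> distinct_triples"
    obtain i j k where ijk: "\<tau> = (i, j, k)" by (cases \<tau>) auto
    have out: "outward_pointing_at \<delta> g1 g2 (i, j, k)"
      using assms(8) \<tau> by (simp add: ijk)
    have "coords (A1 t1) (A2 t1) \<tau> \<notin> M_ss \<delta>"
      using assms(10) \<tau> by (simp add: config_in_Omega_ss_iff)
    \<comment> \<open>Avoiding \<open>M_ss\<close> is a disjunction, and whichever alternative holds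
      at \<open>t1\<close> persists by itself, so no switching between the two has to be
      followed.\<close>
    then have "\<bar>A2 t1 $ i $ j $ k\<bar> < \<delta> \<or>
        \<delta> \<le> \<bar>A1 t1 $ i $ j\<bar> \<and> \<delta> \<le> \<bar>A1 t1 $ i $ k\<bar> \<and> \<delta> \<le> \<bar>A1 t1 $ j $ k\<bar>"
      by (auto simp: ijk coords_def M_ss_def not_le not_less)
    then have "\<bar>A2 t $ i $ j $ k\<bar> < \<delta> \<or>
        \<delta> \<le> \<bar>A1 t $ i $ j\<bar> \<and> \<delta> \<le> \<bar>A1 t $ i $ k\<bar> \<and> \<delta> \<le> \<bar>A1 t $ j $ k\<bar>"
    proof
      assume "\<delta> \<le> \<bar>A1 t1 $ i $ j\<bar> \<and> \<delta> \<le> \<bar>A1 t1 $ i $ k\<bar> \<and> \<delta> \<le> \<bar>A1 t1 $ j $ k\<bar>"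
      then have "\<delta> \<le> \<bar>A1 t $ i' $ j'\<bar>" if "(i', j') \<in> {(i, j), (i, k), (j, k)}" for i' j'
        using edges[OF out _ that] by auto
      then show ?thesis by simp
    qed (use face[OF out] in simp)
    then show "coords (A1 t) (A2 t) \<tau> \<notin> M_ss \<delta>"
      by (auto simp: ijk coords_def M_ss_def)
  qed
qed

end
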